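(* Let $d$ be a positive integer. The set $\mathcal{M}(d)$ of floor multiples of $d$ is a numerical semigroup. It has the following properties. (a) The largest integer not in $\mathcal{M}(d)$ is $d^2 - 1$. (b) There are exactly $\frac{1}{2}(d-1)(d+2) = \frac12(d^2+d-2)$ positive integers not in $\mathcal{M}(d)$. (c) The minimal generating set of $\mathcal{M}(d)$ has $d$ generators, with $\mathcal{M}(d) = \langle \gamma_1, \gamma_2, \ldots, \gamma_d \rangle$ where $\gamma_i = i(d+1) - 1 = (i-1)(d+1) + d$ for $1 \le i \le d$.
   Context: $\mathbb{N}^+ = \{1,2,3,\ldots\}$. For positive integers $d,n$, $d$ is a floor quotient of $n$, written $d \preccurlyeq_1 n$, if $d = \lfloor n/k \rfloor$ for some positive integer $k$; in that case $n$ is called a floor multiple of $d$. The set of floor multiples of $d$ is $\mathcal{M}(d) = \{ n \in \mathbb{N}^+ : d \preccurlyeq_1 n \}$. A numerical semigroup is a subset of $\mathbb{N}^+$ that is closed under addition and contains all but finitely many elements of $\mathbb{N}^+$. $\langle m_1,\ldots,m_r \rangle$ denotes the subset of $\mathbb{N}^+$ consisting of all (positive) nonnegative-integer combinations of $m_1,\ldots,m_r$. A generating set is minimal if no proper subset of it generates the same semigroup. *)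

theory Defs
  imports Complex_Main
begin

definition floor_quotient :: "nat \<Rightarrow> nat \<Rightarrow> bool"  (infix "\<preceq>\<^sub>1" 50) where
  "d \<preceq>\<^sub>1 n \<longleftrightarrow> d > 0 \<and> n > 0 \<and> (\<exists>k::nat. k > 0 \<and> int d = \<lfloor>real n / real k\<rfloor>)"

definition floor_multiples :: "nat \<Rightarrow> nat set" where
  "floor_multiples d = {n. n > 0 \<and> d \<preceq>\<^sub>1 n}"

(* In this convention a numerical semigroup consists of positive integers: it never contains 0. *)
definition numerical_semigroup :: "nat set \<Rightarrow> bool" where
  "numerical_semigroup S \<longleftrightarrow>
     S \<subseteq> {0<..} \<and> (\<forall>a\<in>S. \<forall>b\<in>S. a + b \<in> S) \<and> finite ({0<..} - S)"

(* The condition n > 0 excludes the trivial combination. The set A may be infinite, hence the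
   finite support F. *)
definition generated_semigroup :: "nat set \<Rightarrow> nat set" where
  "generated_semigroup A =
     {n. n > 0 \<and> (\<exists>F (c :: nat \<Rightarrow> nat). finite F \<and> F \<subseteq> A \<and> n = (\<Sum>m\<in>F. c m * m))}"

definition minimal_generating_set :: "nat set \<Rightarrow> nat set \<Rightarrow> bool" where
  "minimal_generating_set S A \<longleftrightarrow>
     generated_semigroup A = S \<and> (\<forall>B. B \<subset> A \<longrightarrow> generated_semigroup B \<noteq> S)"

(* Used only for i \<ge> 1, where the subtraction on naturals does not truncate. *)
definition floor_gen :: "nat \<Rightarrow> nat \<Rightarrow> nat" where
  "floor_gen d i = i * (d + 1) - 1"

end

theory Submission
  imports Defs
begin

text \<open>
  The equation \<open>\<lfloor>n / k\<rfloor> = d\<close> says \<open>k d \<le> n < k (d + 1)\<close>, so the floor multiples of \<open>d\<close> are the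
  union over \<open>k > 0\<close> of the blocks \<open>[k d, k d + k - 1]\<close>.  The sum of an element of block \<open>k\<close> and
  one of block \<open>l\<close> lies in block \<open>k + l\<close>, which gives closure under addition.

  The only block that matters for a given \<open>n\<close> is the last one that starts at or before \<open>n\<close>, because
  the right ends \<open>k (d + 1) - 1\<close> increase with \<open>k\<close>.  Hence \<open>n\<close> is a floor multiple of \<open>d\<close> iff
  \<open>n mod d < n div d\<close> (lemma \<open>floor_multiples_iff_mod_less_div\<close>).  In the coordinates
  \<open>n = q d + r\<close> with \<open>r < d\<close> the gaps, including \<open>0\<close>, are therefore the lattice points of the
  triangle \<open>q \<le> r < d\<close>.  There are \<open>d (d + 1) / 2\<close> of them, and the corner \<open>q = r = d - 1\<close> is the
  largest one, \<open>d\<^sup>2 - 1\<close>.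

  The number \<open>\<gamma>\<^sub>i = i d + (i - 1)\<close> is the right end of block \<open>i\<close>.  A point \<open>q d + r\<close> outside the
  triangle is \<open>\<gamma>\<^bsub>r+1\<^esub> + (q - r - 1) \<gamma>\<^sub>1\<close>, so \<open>\<gamma>\<^sub>1, \<dots>, \<gamma>\<^sub>d\<close> generate.  They are also atoms, that
  is, not sums of two floor multiples: such a sum falls short of the right end of its block by at
  least one, so to reach \<open>\<gamma>\<^sub>i\<close> it has to lie in a block that starts at \<open>(i + 1) d > \<gamma>\<^sub>i\<close> or later.
  Every generating set contains all atoms, so a generating set made of atoms is
  contained in every generating set, and hence is the only minimal one.
\<close>

section \<open>Generated semigroups and atoms\<close>

lemma generated_semigroupI:
  "finite F \<Longrightarrow> F \<subseteq> A \<Longrightarrow> n = (\<Sum>m\<in>F. c m * m) \<Longrightarrow> n > 0 \<Longrightarrow> n \<in> generated_semigroup A"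
  unfolding generated_semigroup_def by blast

lemma generator_in_generated_semigroup:
  assumes "m \<in> A" "m > 0"
  shows "m \<in> generated_semigroup A"
  by (rule generated_semigroupI[of "{m}" A m "\<lambda>_. 1"]) (use assms in auto)

lemma generated_semigroup_add:
  assumes "a \<in> generated_semigroup A" "b \<in> generated_semigroup A"
  shows "a + b \<in> generated_semigroup A"
proof -
  obtain F c where F: "finite F" "F \<subseteq> A" and a: "a = (\<Sum>m\<in>F. c m * m)" "a > 0"
    using assms(1) unfolding generated_semigroup_def by blast
  obtain H e where H: "finite H" "H \<subseteq> A" and b: "b = (\<Sum>m\<in>H. e m * m)"
    using assms(2) unfolding generated_semigroup_def by blast
  define c' where "c' m = (if m \<in> F then c m else 0)" for m
  define e' where "e' m = (if m \<in> H then e m else 0)" for m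
  have "(\<Sum>m\<in>F. c m * m) = (\<Sum>m\<in>F \<union> H. c' m * m)"
    by (rule sum.mono_neutral_cong_left) (use F H in \<open>auto simp: c'_def\<close>)
  moreover have "(\<Sum>m\<in>H. e m * m) = (\<Sum>m\<in>F \<union> H. e' m * m)"
    by (rule sum.mono_neutral_cong_left) (use F H in \<open>auto simp: e'_def\<close>)
  ultimately have "a + b = (\<Sum>m\<in>F \<union> H. (c' m + e' m) * m)"
    using a b by (simp add: sum.distrib distrib_right)
  then show ?thesis
    using F H a(2) by (intro generated_semigroupI[of "F \<union> H" _ _ "\<lambda>m. c' m + e' m"]) auto
qed

lemma generated_semigroup_least:
  assumes "A \<subseteq> S" and add: "\<And>a b. a \<in> S \<Longrightarrow> b \<in> S \<Longrightarrow> a + b \<in> S"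
  shows "generated_semigroup A \<subseteq> S"
proof
  fix n assume "n \<in> generated_semigroup A"
  then obtain F c where F: "finite F" "F \<subseteq> A" and n: "n = (\<Sum>m\<in>F. c m * m)" "n > 0"
    unfolding generated_semigroup_def by blast
  \<comment> \<open>\<open>S\<close> may omit \<open>0\<close>, so \<open>0\<close> has to be adjoined for the empty combination.\<close>
  have add0: "a + b \<in> insert 0 S" if "a \<in> insert 0 S" "b \<in> insert 0 S" for a b
    using that add by auto
  have mult: "k * m \<in> insert 0 S" if "m \<in> S" for k m :: nat
  proof (induction k)
    case (Suc k)
    then show ?case using add0[of m "k * m"] that by auto
  qed simp
  have "(\<Sum>m\<in>F. c m * m) \<in> insert 0 S"
    using F
  proof (induction F rule: finite_induct)
    case (insert x F)
    have "x \<in> S" using insert.prems \<open>A \<subseteq> S\<close> by blast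
    then have "c x * x + (\<Sum>m\<in>F. c m * m) \<in> insert 0 S"
      using insert by (intro add0 mult) auto
    then show ?case
      unfolding sum.insert[OF insert.hyps] .
  qed simp
  then show "n \<in> S" using n by auto
qed

definition semigroup_atom :: "nat set \<Rightarrow> nat \<Rightarrow> bool" where
  "semigroup_atom S n \<longleftrightarrow> n \<in> S \<and> (\<forall>a\<in>S. \<forall>b\<in>S. n \<noteq> a + b)"

text \<open>Splitting one copy of a generator off a combination with value \<open>n\<close> writes \<open>n\<close> as a sum of
  two elements of the semigroup, unless nothing remains, and then \<open>n\<close> is that generator.\<close>

lemma atom_in_generating_set:
  assumes "semigroup_atom (generated_semigroup A) n"
  shows "n \<in> A"
proof -
  have "n \<in> generated_semigroup A"
    using assms by (simp add: semigroup_atom_def)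
  then obtain F c where F: "finite F" "F \<subseteq> A" and n: "n = (\<Sum>m\<in>F. c m * m)" "n > 0"
    unfolding generated_semigroup_def by blast
  from n have "(\<Sum>m\<in>F. c m * m) \<noteq> 0" by simp
  then obtain m where m: "m \<in> F" "c m * m \<noteq> 0"
    using F(1) by (auto simp: sum_eq_0_iff)
  define c' where "c' = c(m := c m - 1)"
  define rest where "rest = (\<Sum>j\<in>F. c' j * j)"
  have "(\<Sum>j\<in>F - {m}. c' j * j) = (\<Sum>j\<in>F - {m}. c j * j)"
    by (rule sum.cong) (auto simp: c'_def)
  moreover have "m + c' m * m = c m * m"
    using m by (cases "c m") (auto simp: c'_def)
  ultimately have split: "n = m + rest"
    using n(1) F(1) m(1) by (simp add: rest_def sum.remove)
  have "m \<in> generated_semigroup A"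
    using F m by (intro generator_in_generated_semigroup) auto
  moreover have "rest \<in> generated_semigroup A" if "rest > 0"
    using F that by (intro generated_semigroupI[of F A rest c']) (auto simp: rest_def)
  ultimately have "rest = 0"
    using assms split unfolding semigroup_atom_def by blast
  then show ?thesis using split m F by auto
qed

text \<open>The atoms lie in every generating set, so a minimal one cannot properly contain \<open>G\<close>, and no
  proper subset of \<open>G\<close> generates.\<close>

lemma minimal_generating_set_atoms:
  assumes gen: "generated_semigroup G = S" and atoms: "\<And>g. g \<in> G \<Longrightarrow> semigroup_atom S g"
  shows "minimal_generating_set S A \<longleftrightarrow> A = G"
proof -
  have "G \<subseteq> B" if "generated_semigroup B = S" for B
    using atoms atom_in_generating_set that by blast
  then show ?thesis
    using gen unfolding minimal_generating_set_def by blast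
qed

section \<open>Blocks of floor multiples\<close>

lemma floor_multiples_iff_block:
  assumes "d > 0"
  shows "n \<in> floor_multiples d \<longleftrightarrow> (\<exists>k. k * d \<le> n \<and> n < k * (d + 1))"
proof -
  have "int d = \<lfloor>real n / real k\<rfloor> \<longleftrightarrow> k * d \<le> n \<and> n < k * (d + 1)" if "k > 0" for k
  proof -
    have "int d = \<lfloor>real n / real k\<rfloor> \<longleftrightarrow> n div k = d"
      by (metis floor_divide_of_nat_eq of_nat_eq_iff)
    also have "\<dots> \<longleftrightarrow> k * d \<le> n \<and> n < k * (d + 1)"
      using that dividend_less_div_times[of k n] times_div_less_eq_dividend[of k n]
      by (auto simp: mult.commute intro!: div_nat_eqI)
    finally show ?thesis .
  qed
  moreover have "k > 0 \<and> n > 0" if "k * d \<le> n" "n < k * (d + 1)" for k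
    using that assms by (cases "k = 0") (auto intro: Nat.gr0I)
  ultimately show ?thesis
    using assms unfolding floor_multiples_def floor_quotient_def by blast
qed

text \<open>Block \<open>n div d\<close> is the last one that starts at or before \<open>n\<close>, and it contains \<open>n\<close> as soon as
  any block does.\<close>

lemma floor_multiples_iff_mod_less_div:
  assumes "d > 0"
  shows "n \<in> floor_multiples d \<longleftrightarrow> n mod d < n div d"
proof -
  have n: "n = n div d * d + n mod d" by simp
  have "n < (n div d) * (d + 1)" if "k * d \<le> n" "n < k * (d + 1)" for k
  proof -
    have "k \<le> n div d"
      using that(1) assms by (simp add: less_eq_div_iff_mult_less_eq)
    then show ?thesis
      using that(2) by (meson less_le_trans mult_le_mono1)
  qed
  moreover have "(n div d) * d \<le> n" by simp
  moreover have "n < (n div d) * (d + 1) \<longleftrightarrow> n mod d < n div d"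
    using n unfolding distrib_left mult_1_right by linarith
  ultimately show ?thesis
    unfolding floor_multiples_iff_block[OF assms] by blast
qed

lemma floor_multiples_add:
  assumes "d > 0" "a \<in> floor_multiples d" "b \<in> floor_multiples d"
  shows "a + b \<in> floor_multiples d"
proof -
  obtain k l where "k * d \<le> a" "a < k * (d + 1)" "l * d \<le> b" "b < l * (d + 1)"
    using assms by (auto simp: floor_multiples_iff_block)
  then have "(k + l) * d \<le> a + b" "a + b < (k + l) * (d + 1)"
    unfolding distrib_right by linarith+
  then show ?thesis
    using assms(1) floor_multiples_iff_block by blast
qed

section \<open>Gaps\<close>

lemma floor_multiples_ge_square:
  assumes "d > 0" "d ^ 2 \<le> n"
  shows "n \<in> floor_multiples d"
proof -
  have "d \<le> n div d"
    using assms by (simp add: less_eq_div_iff_mult_less_eq power2_eq_square)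
  then show ?thesis
    using assms(1) less_le_trans[OF mod_less_divisor[of d n]]
    by (simp add: floor_multiples_iff_mod_less_div)
qed

lemma finite_non_floor_multiples:
  assumes "d > 0"
  shows "finite (- floor_multiples d)"
proof (rule finite_subset)
  show "- floor_multiples d \<subseteq> {..<d ^ 2}"
    using floor_multiples_ge_square[OF assms] by (meson ComplD lessThan_iff not_le subsetI)
qed simp

lemma square_minus_one_not_floor_multiple:
  assumes "d > 0"
  shows "d ^ 2 - 1 \<notin> floor_multiples d"
proof -
  have eq: "d ^ 2 - 1 = (d - 1) * d + (d - 1)"
    using assms by (cases d) (auto simp: power2_eq_square)
  have "(d ^ 2 - 1) div d = d - 1" "(d ^ 2 - 1) mod d = d - 1"
    unfolding eq using assms by (simp_all only: div_mult_self3 mod_mult_self3) simp_all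
  then show ?thesis
    using assms by (simp add: floor_multiples_iff_mod_less_div)
qed

text \<open>Counting \<open>0\<close> along with the gaps makes them a full triangle in the coordinates
  \<open>(n mod d, n div d)\<close>.\<close>

lemma card_non_floor_multiples:
  assumes "d > 0"
  shows "2 * card (- floor_multiples d) = d * (d + 1)"
proof -
  let ?T = "SIGMA r:{..<d}. {..r}"
  have "bij_betw (\<lambda>(r, q). q * d + r) ?T (- floor_multiples d)"
    by (rule bij_betw_byWitness[where f' = "\<lambda>n. (n mod d, n div d)"])
       (use assms in \<open>auto simp: floor_multiples_iff_mod_less_div not_less\<close>)
  then have "card (- floor_multiples d) = card ?T"
    by (simp add: bij_betw_same_card)
  also have "\<dots> = (\<Sum>r<d. r + 1)" by simp
  finally have "card (- floor_multiples d) = (\<Sum>r<d. r + 1)" .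
  moreover have "2 * (\<Sum>r<d. r + 1) = d * (d + 1)"
    by (induction d) (auto simp: algebra_simps)
  ultimately show ?thesis by simp
qed

lemma card_positive_gaps:
  assumes "d > 0"
  shows "real (card {n. n > 0 \<and> n \<notin> floor_multiples d}) = 1/2 * (real d - 1) * (real d + 2)"
proof -
  let ?G = "{n. n > 0 \<and> n \<notin> floor_multiples d}"
  have "- floor_multiples d = insert 0 ?G"
    by (auto simp: floor_multiples_def)
  moreover have "finite ?G"
    using finite_non_floor_multiples[OF assms] by (rule finite_subset[rotated]) auto
  ultimately have "card (- floor_multiples d) = card ?G + 1" by simp
  then have "2 * (card ?G + 1) = d * (d + 1)"
    using card_non_floor_multiples[OF assms] by simp
  then have "real (2 * (card ?G + 1)) = real (d * (d + 1))"
    by (rule arg_cong)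
  then show ?thesis by (simp add: field_simps)
qed

lemma numerical_semigroup_floor_multiples:
  assumes "d > 0"
  shows "numerical_semigroup (floor_multiples d)"
proof -
  have "finite ({0<..} - floor_multiples d)"
    using finite_non_floor_multiples[OF assms] by (rule finite_subset[rotated]) auto
  moreover have "floor_multiples d \<subseteq> {0<..}"
    by (auto simp: floor_multiples_def)
  ultimately show ?thesis
    using assms floor_multiples_add by (simp add: numerical_semigroup_def)
qed

section \<open>Generators\<close>

lemma floor_gen_eq: "i \<ge> 1 \<Longrightarrow> floor_gen d i = (i - 1) * (d + 1) + d"
  by (cases i) (auto simp: floor_gen_def)

lemma inj_on_floor_gen: "inj_on (floor_gen d) {1..d}"
proof (rule inj_onI)
  fix i j assume "i \<in> {1..d}" "j \<in> {1..d}" "floor_gen d i = floor_gen d j"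
  then have "(i - 1) * (d + 1) = (j - 1) * (d + 1)" "i \<ge> 1" "j \<ge> 1"
    by (simp_all only: floor_gen_eq atLeastAtMost_iff add_right_cancel)
  then have "i - 1 = j - 1" by (metis mult_cancel2 add_is_0 zero_neq_one)
  then show "i = j" using \<open>i \<ge> 1\<close> \<open>j \<ge> 1\<close> by linarith
qed

lemma floor_gen_in_floor_multiples:
  assumes "d > 0" "i \<ge> 1"
  shows "floor_gen d i \<in> floor_multiples d"
  using assms by (auto simp: floor_multiples_iff_block floor_gen_def intro!: exI[of _ i])

text \<open>Two summands from blocks \<open>k\<close> and \<open>l\<close> add up to at most \<open>(k + l) (d + 1) - 2\<close>, so reaching
  \<open>\<gamma>\<^sub>i\<close> forces \<open>k + l > i\<close>; but then the sum is at least \<open>(i + 1) d\<close>, which exceeds \<open>\<gamma>\<^sub>i\<close>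
  exactly because \<open>i \<le> d\<close>.\<close>

lemma floor_gen_atom:
  assumes "i \<in> {1..d}"
  shows "semigroup_atom (floor_multiples d) (floor_gen d i)"
proof -
  have d: "d > 0" using assms by auto
  have "floor_gen d i \<noteq> a + b"
    if ab: "a \<in> floor_multiples d" "b \<in> floor_multiples d" for a b
  proof
    assume eq: "floor_gen d i = a + b"
    obtain k l where kl: "k * d \<le> a" "a < k * (d + 1)" "l * d \<le> b" "b < l * (d + 1)"
      using ab unfolding floor_multiples_iff_block[OF d] by blast
    have gen: "floor_gen d i + 1 = i * (d + 1)"
      using assms by (simp add: floor_gen_def)
    have "i * (d + 1) < (k + l) * (d + 1)"
      using kl eq gen unfolding distrib_right[of k l] by linarith
    then have "i + 1 \<le> k + l" by (metis Suc_eq_plus1 Suc_leI mult_less_cancel2)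
    then have "(i + 1) * d \<le> (k + l) * d" by (rule mult_le_mono1)
    also have "\<dots> \<le> floor_gen d i"
      using kl eq by (simp add: distrib_right)
    finally have "(i + 1) * d < i * (d + 1)" using gen by linarith
    then show False using assms by simp
  qed
  then show ?thesis
    using assms d floor_gen_in_floor_multiples by (simp add: semigroup_atom_def)
qed

lemma generated_semigroup_floor_gen:
  assumes "d > 0"
  shows "generated_semigroup (floor_gen d ` {1..d}) = floor_multiples d" (is "?S = _")
proof
  show "?S \<subseteq> floor_multiples d"
    by (rule generated_semigroup_least)
       (use assms floor_multiples_add floor_gen_in_floor_multiples in auto)
  show "floor_multiples d \<subseteq> ?S"
  proof
    fix n assume "n \<in> floor_multiples d"
    define r where "r = n mod d"
    have r: "r < d" using assms by (simp add: r_def)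
    have "r < n div d"
      using \<open>n \<in> floor_multiples d\<close> assms by (simp add: floor_multiples_iff_mod_less_div r_def)
    then obtain t where t: "n div d = r + 1 + t"
      by (metis less_iff_Suc_add Suc_eq_plus1 add.commute add.left_commute)
    have gen: "floor_gen d i \<in> ?S" if "i \<in> {1..d}" for i
      using that assms by (intro generator_in_generated_semigroup) (auto simp: floor_gen_eq)
    have "d \<in> ?S"
      using gen[of 1] assms by (simp add: floor_gen_def)
    have "floor_gen d (r + 1) + t * d \<in> ?S"
    proof (induction t)
      case 0
      then show ?case using gen[of "r + 1"] r by simp
    next
      case (Suc t)
      then show ?case
        using generated_semigroup_add[OF \<open>d \<in> ?S\<close>] by (simp add: add.left_commute)
    qed
    moreover have "n = floor_gen d (r + 1) + t * d"
      using div_mult_mod_eq[of n d] unfolding t r_def[symmetric]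
      by (simp add: floor_gen_eq algebra_simps)
    ultimately show "n \<in> ?S" by simp
  qed
qed

section \<open>The semigroup of floor multiples\<close>

theorem theorem3p8:
  fixes d :: nat
  assumes "d > 0"
  shows "numerical_semigroup (floor_multiples d)
    \<and> (int d ^ 2 - 1 \<notin> int ` floor_multiples d
        \<and> (\<forall>z::int. z \<notin> int ` floor_multiples d \<longrightarrow> z \<le> int d ^ 2 - 1))
    \<and> (real (card {n::nat. n > 0 \<and> n \<notin> floor_multiples d}) = 1/2 * (real d - 1) * (real d + 2)
        \<and> 1/2 * (real d - 1) * (real d + 2) = 1/2 * (real d ^ 2 + real d - 2))
    \<and> ((\<forall>A. minimal_generating_set (floor_multiples d) A \<longleftrightarrow> A = floor_gen d ` {1..d})
        \<and> card (floor_gen d ` {1..d}) = d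
        \<and> floor_multiples d = generated_semigroup (floor_gen d ` {1..d})
        \<and> (\<forall>i\<in>{1..d}. floor_gen d i = (i - 1) * (d + 1) + d))"
proof (intro conjI allI impI ballI)
  show "numerical_semigroup (floor_multiples d)"
    by (rule numerical_semigroup_floor_multiples[OF assms])
  have "int d ^ 2 - 1 = int (d ^ 2 - 1)"
    using assms by (simp)
  then show "int d ^ 2 - 1 \<notin> int ` floor_multiples d"
    using square_minus_one_not_floor_multiple[OF assms] by (simp add: inj_image_mem_iff)
  show "z \<le> int d ^ 2 - 1" if "z \<notin> int ` floor_multiples d" for z
  proof (rule ccontr)
    assume "\<not> z \<le> int d ^ 2 - 1"
    then have z: "int (d ^ 2) \<le> z" by simp
    have "int (nat z) = z"
      by (rule int_nat_eq[THEN trans]) (use order_trans[OF of_nat_0_le_iff z] in simp)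
    moreover have "nat z \<in> floor_multiples d"
      using nat_mono[OF z] unfolding nat_int by (rule floor_multiples_ge_square[OF assms])
    ultimately show False
      using that by (metis imageI)
  qed
  show "real (card {n. n > 0 \<and> n \<notin> floor_multiples d}) = 1/2 * (real d - 1) * (real d + 2)"
    by (rule card_positive_gaps[OF assms])
  show "1/2 * (real d - 1) * (real d + 2) = 1/2 * (real d ^ 2 + real d - 2)"
    by (simp add: field_simps power2_eq_square)
  show "minimal_generating_set (floor_multiples d) A \<longleftrightarrow> A = floor_gen d ` {1..d}" for A
    by (rule minimal_generating_set_atoms)
       (use assms generated_semigroup_floor_gen floor_gen_atom in auto)
  show "card (floor_gen d ` {1..d}) = d"
    using card_image[OF inj_on_floor_gen] by simp
  show "floor_multiples d = generated_semigroup (floor_gen d ` {1..d})"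
    by (rule generated_semigroup_floor_gen[OF assms, symmetric])
  show "floor_gen d i = (i - 1) * (d + 1) + d" if "i \<in> {1..d}" for i
    using that by (simp add: floor_gen_eq)
qed

end
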